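(* Let $\mathcal{X}=(X_1,\dots,X_n)$ be a realization of $\mathcal{C}\subseteq 2^{[n]}$ consisting of closed polygons in $\mathbb{R}^2$. Then the total number of vertices among the polygons in $\mathcal{X}$ is at least $|\mathcal{C}|/(8n)$.
   Context: Write $[n]=\{1,\dots,n\}$. For a tuple $\mathcal{X}=(X_1,\dots,X_n)$ of bounded convex subsets of $\mathbb{R}^2$ and a point $p\in\mathbb{R}^2$, the intersection pattern of $\mathcal{X}$ at $p$ is $\operatorname{patt}_{\mathcal{X}}(p)=\{i\in[n] : p\in X_i\}$, and the convex code of $\mathcal{X}$ is $\operatorname{code}(\mathcal{X})=\{\operatorname{patt}_{\mathcal{X}}(p) : p\in\mathbb{R}^2\}\subseteq 2^{[n]}$. The tuple $\mathcal{X}$ is a realization of $\mathcal{C}$ if $\operatorname{code}(\mathcal{X})=\mathcal{C}$. A closed polygon here means a closed convex polygon, i.e. the convex hull of finitely many points of $\mathbb{R}^2$; it may degenerate to a line segment or a point. Its vertices are its extreme points, and the total number of vertices is the sum over $i\in[n]$ of the number of vertices of $X_i$. *)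

theory Defs
  imports "HOL-Analysis.Analysis"
begin

text \<open>
  A tuple \<open>(X\<^sub>1, \<dots>, X\<^sub>n)\<close> is a function \<open>X\<close> on \<open>nat\<close> together with its length \<open>n\<close>;
  only the values of \<open>X\<close> on \<open>{1..n}\<close> are used.
\<close>

definition patt :: "nat \<Rightarrow> (nat \<Rightarrow> (real ^ 2) set) \<Rightarrow> real ^ 2 \<Rightarrow> nat set" where
  "patt n X p = {i \<in> {1..n}. p \<in> X i}"

definition convex_code :: "nat \<Rightarrow> (nat \<Rightarrow> (real ^ 2) set) \<Rightarrow> nat set set" where
  "convex_code n X = {patt n X p | p. p \<in> UNIV}"

definition realization :: "nat \<Rightarrow> (nat \<Rightarrow> (real ^ 2) set) \<Rightarrow> nat set set \<Rightarrow> bool" where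
  "realization n X C \<longleftrightarrow>
     (\<forall>i \<in> {1..n}. bounded (X i) \<and> convex (X i)) \<and> convex_code n X = C"

text \<open>
  Segments and single points count as polygons. The empty set, which is a \<^const>\<open>polytope\<close> in the
  library, does not: a tuple of empty sets has the one-element code \<open>{{}}\<close> but no vertices.
\<close>

definition closed_polygon :: "(real ^ 2) set \<Rightarrow> bool" where
  "closed_polygon P \<longleftrightarrow> polytope P \<and> P \<noteq> {}"

definition num_vertices :: "(real ^ 2) set \<Rightarrow> nat" where
  "num_vertices P = card {v. v extreme_point_of P}"

end

theory Submission
  imports Defs
begin

text \<open>
  Fix a direction \<open>u\<close>. Moving from a point with a nonempty pattern \<open>\<sigma>\<close> in direction \<open>u\<close>, one
  finally either leaves a polygon of \<open>\<sigma>\<close> at a point whose pattern is still \<open>\<sigma>\<close>, or enters a polygon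
  outside \<open>\<sigma>\<close>, in which case \<open>\<sigma>\<close> is the pattern seen just before the point of entry. The points
  where a polygon can be left, or entered, lie on as many segments as it has vertices, by sending an
  edge to its left endpoint. On each segment the polygons induce \<open>n\<close> intervals, and \<open>n\<close> intervals
  have at most \<open>2n + 1\<close> patterns. With \<open>V\<close> vertices, this gives at most
  \<open>1 + 2V(2n + 1) \<le> 8nV\<close> patterns.
\<close>

subsection \<open>Patterns of intervals\<close>

text \<open>Members of a chain of finite sets are determined by their size, and the sizes range over
  \<open>0\<close> to \<open>card K\<close>.\<close>

lemma card_chain_le:
  assumes "finite K" and "\<And>A. A \<in> \<P> \<Longrightarrow> A \<subseteq> K"
    and "\<And>A B. A \<in> \<P> \<Longrightarrow> B \<in> \<P> \<Longrightarrow> A \<subseteq> B \<or> B \<subseteq> A"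
  shows "card \<P> \<le> card K + 1"
proof -
  have "inj_on card \<P>"
    using assms by (intro inj_onI) (metis card_subset_eq finite_subset)
  moreover have "card ` \<P> \<subseteq> {..card K}"
    using assms(1,2) by (auto intro: card_mono)
  ultimately have "card \<P> \<le> card {..card K}"
    by (intro card_inj_on_le) auto
  then show ?thesis by simp
qed

text \<open>An interval is the difference of two down-sets, and down-sets of a line form a chain.\<close>

lemma card_interval_patterns_le:
  fixes A :: "nat \<Rightarrow> real set"
  assumes "\<And>i. i \<in> {1..n} \<Longrightarrow> convex (A i)"
  shows "card (range (\<lambda>x. {i \<in> {1..n}. x \<in> A i})) \<le> 2 * n + 1"
proof -
  define K where "K = {1..n} <+> {1..n}"
  \<comment> \<open>The left summand lists the intervals that reach \<open>x\<close> or some point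
    beyond it, the right one those wholly beyond \<open>x\<close>. Both shrink as \<open>x\<close>
    grows, so one chain inside a set of size \<open>2 * n\<close> carries both kinds of
    down-sets.\<close>
  define M where "M x = {i \<in> {1..n}. \<exists>a\<in>A i. x \<le> a} <+> {i \<in> {1..n}. \<forall>a\<in>A i. x < a}" for x
  have anti: "M y \<subseteq> M x" if "x \<le> y" for x y
    using that unfolding M_def by (auto intro: order_trans le_less_trans)
  have finK: "finite K" and cardK: "card K = 2 * n"
    by (auto simp: K_def card_Plus)
  have sub: "M x \<subseteq> K" for x
    by (auto simp: M_def K_def)
  have finM: "finite (range M)"
    using sub finK by (meson finite_Pow_iff finite_subset image_subsetI PowI)
  have "card (range M) \<le> card K + 1"
    using sub anti by (intro card_chain_le finK) (auto, meson linear subsetD)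
  \<comment> \<open>The pattern at \<open>x\<close> is a function of \<open>M x\<close>. Convexity
    enters here: a point of \<open>A i\<close> at or before \<open>x\<close> and another at or after
    \<open>x\<close> force \<open>x\<close> into \<open>A i\<close>.\<close>
  moreover have "{i \<in> {1..n}. x \<in> A i} = {i. Inl i \<in> M x \<and> Inr i \<notin> M x}" for x
  proof -
    have "x < b" if "i \<in> {1..n}" "a \<in> A i" "x \<le> a" "b \<in> A i" "x \<notin> A i" for i a b
      using assms[OF that(1)] that(2-) unfolding is_interval_convex_1[symmetric]
      by (meson mem_is_interval_1_I not_less)
    then show ?thesis
      by (auto simp: M_def)
  qed
  then have "range (\<lambda>x. {i \<in> {1..n}. x \<in> A i})
      = (\<lambda>N. {i. Inl i \<in> N \<and> Inr i \<notin> N}) ` range M"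
    by (simp add: image_image)
  ultimately show ?thesis
    using card_image_le[OF finM, of "\<lambda>N. {i. Inl i \<in> N \<and> Inr i \<notin> N}"] cardK by simp
qed

lemma finite_patt_image: "finite (patt n G ` T)"
  by (rule finite_subset[of _ "Pow {1..n}"]) (auto simp: patt_def)

text \<open>Projection to the first coordinate loses nothing on \<open>T\<close> and turns each
  \<open>T \<inter> G i\<close> into an interval, closed or not.\<close>

lemma card_patt_on_graph_le:
  assumes T: "convex T" "inj_on (\<lambda>q. q $ 1) T"
    and G: "\<And>i. i \<in> {1..n} \<Longrightarrow> convex (G i)"
  shows "card (patt n G ` T) \<le> 2 * n + 1"
proof -
  define A where "A i = (\<lambda>q. q $ 1) ` (T \<inter> G i)" for i
  have "convex (A i)" if "i \<in> {1..n}" for i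
    unfolding A_def using T G[OF that]
    by (intro convex_linear_image convex_Int) (auto intro: linearI)
  then have le: "card (range (\<lambda>x. {i \<in> {1..n}. x \<in> A i})) \<le> 2 * n + 1"
    by (rule card_interval_patterns_le)
  have "patt n G q = {i \<in> {1..n}. q $ 1 \<in> A i}" if "q \<in> T" for q
    using that T(2) by (auto simp: patt_def A_def inj_on_def)
  then have "patt n G ` T \<subseteq> range (\<lambda>x. {i \<in> {1..n}. x \<in> A i})"
    by auto
  moreover have "finite (range (\<lambda>x. {i \<in> {1..n}. x \<in> A i}))"
    by (rule finite_subset[of _ "Pow {1..n}"]) auto
  ultimately have "card (patt n G ` T) \<le> card (range (\<lambda>x. {i \<in> {1..n}. x \<in> A i}))"
    by (intro card_mono)
  then show ?thesis
    using le by (rule le_trans)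
qed

subsection \<open>The part of the boundary seen from a direction\<close>

text \<open>For vertical \<open>u\<close> and compact convex \<open>P\<close> this is the upper or
  lower boundary; of a vertical side it keeps only the end furthest along \<open>u\<close>.\<close>

definition rim :: "real ^ 2 \<Rightarrow> (real ^ 2) set \<Rightarrow> (real ^ 2) set" where
  "rim u P = {q \<in> P. \<forall>t>0. q + t *\<^sub>R u \<notin> P}"

text \<open>For vertical \<open>u\<close>, a polygon \<open>P\<close> and an extreme point
  \<open>v\<close> on its rim, this is the edge in the rim with left endpoint \<open>v\<close>, or
  \<open>{v}\<close> if there is none. Taking a union of segments avoids naming the edges.\<close>

definition rim_from :: "real ^ 2 \<Rightarrow> (real ^ 2) set \<Rightarrow> real ^ 2 \<Rightarrow> (real ^ 2) set" where
  "rim_from u P v = \<Union>{closed_segment v w | w. v $ 1 \<le> w $ 1 \<and> closed_segment v w \<subseteq> rim u P}"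

lemma rim_in: "q \<in> rim u P \<Longrightarrow> q \<in> P"
  by (simp add: rim_def)

lemma rim_le_0: "q \<in> rim u P \<Longrightarrow> q + t *\<^sub>R u \<in> P \<Longrightarrow> t \<le> 0"
  unfolding rim_def by (metis (mono_tags, lifting) mem_Collect_eq not_le)

lemma vertical_diffE:
  fixes u q r :: "real ^ 2"
  assumes "u $ 1 = 0" "u $ 2 \<noteq> 0" "q $ 1 = r $ 1"
  obtains c where "r = q + c *\<^sub>R u"
proof
  show "r = q + ((r $ 2 - q $ 2) / u $ 2) *\<^sub>R u"
    using assms by (simp add: vec_eq_iff forall_2)
qed

lemma inj_on_rim:
  assumes "u $ 1 = 0" "u $ 2 \<noteq> 0"
  shows "inj_on (\<lambda>q. q $ 1) (rim u P)"
proof (rule inj_onI)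
  fix q r assume q: "q \<in> rim u P" and r: "r \<in> rim u P" and "q $ 1 = r $ 1"
  then obtain c where c: "r = q + c *\<^sub>R u"
    using vertical_diffE assms by metis
  then have "q = r + (- c) *\<^sub>R u" by simp
  then have "c \<le> 0" "- c \<le> 0"
    using q r c rim_in rim_le_0 by metis+
  then show "q = r" using c by simp
qed

lemma rim_from_subset: "rim_from u P v \<subseteq> rim u P"
  by (auto simp: rim_from_def)

lemma closed_segment_coordinateE:
  fixes v w :: "real ^ 2"
  assumes "v $ 1 \<le> x" "x \<le> w $ 1"
  obtains r where "r \<in> closed_segment v w" "r $ 1 = x"
proof -
  have "x \<in> closed_segment (v $ 1) (w $ 1)"
    using assms by (simp add: closed_segment_eq_real_ivl)
  also have "\<dots> = (\<lambda>q. q $ 1) ` closed_segment v w"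
    by (rule closed_segment_linear_image) (auto intro: linearI)
  finally show thesis using that by auto
qed

text \<open>The rim is a graph over the first coordinate, so of two segments in it that start at
  \<open>v\<close> and run to the right, one contains the other. Hence any two points of the union
  share a segment.\<close>

lemma convex_rim_from:
  assumes u: "u $ 1 = 0" "u $ 2 \<noteq> 0"
  shows "convex (rim_from u P v)"
proof -
  have nested: "closed_segment v w \<subseteq> closed_segment v w'"
    if w: "v $ 1 \<le> w $ 1" "w $ 1 \<le> w' $ 1"
      "closed_segment v w \<subseteq> rim u P" "closed_segment v w' \<subseteq> rim u P" for w w'
  proof -
    obtain r where "r \<in> closed_segment v w'" "r $ 1 = w $ 1"
      using closed_segment_coordinateE w(1,2) by metis
    then have "w \<in> closed_segment v w'"
      using inj_onD[OF inj_on_rim[OF u], of r w P] w(3,4) by auto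
    then show ?thesis by (simp add: subset_closed_segment)
  qed
  show ?thesis
  proof (rule convexI)
    fix x y :: "real ^ 2" and a b :: real
    assume xy: "x \<in> rim_from u P v" "y \<in> rim_from u P v" and ab: "0 \<le> a" "0 \<le> b" "a + b = 1"
    obtain w where w: "v $ 1 \<le> w $ 1" "closed_segment v w \<subseteq> rim u P" "x \<in> closed_segment v w"
      using xy(1) unfolding rim_from_def by auto
    obtain w' where w': "v $ 1 \<le> w' $ 1" "closed_segment v w' \<subseteq> rim u P" "y \<in> closed_segment v w'"
      using xy(2) unfolding rim_from_def by auto
    obtain z where z: "v $ 1 \<le> z $ 1" "closed_segment v z \<subseteq> rim u P"
      "x \<in> closed_segment v z" "y \<in> closed_segment v z"
    proof (cases "w $ 1 \<le> w' $ 1")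
      case True
      then show thesis using that[of w'] nested[of w w'] w w' by blast
    next
      case False
      then show thesis using that[of w] nested[of w' w] w w' by auto
    qed
    then have "a *\<^sub>R x + b *\<^sub>R y \<in> closed_segment v z"
      using ab convexD[OF convex_closed_segment] by blast
    then show "a *\<^sub>R x + b *\<^sub>R y \<in> rim_from u P v"
      unfolding rim_from_def using z by blast
  qed
qed

text \<open>The sets \<open>G i\<close> are independent of \<open>P\<close>, so that they can be the
  polygons themselves as well as their germs.\<close>

lemma card_patt_rim_from_le:
  assumes "u $ 1 = 0" "u $ 2 \<noteq> 0" and "\<And>i. i \<in> {1..n} \<Longrightarrow> convex (G i)"
  shows "card (patt n G ` rim_from u P v) \<le> 2 * n + 1"
  using assms
  by (intro card_patt_on_graph_le convex_rim_from inj_on_subset[OF inj_on_rim rim_from_subset])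

text \<open>The open ray from \<open>p\<close> along \<open>u\<close> misses \<open>P\<close>. A
  line separating the two passes through \<open>p\<close>, which lies in \<open>P\<close> and is a
  limit of the ray.\<close>

lemma rim_supporting_normalE:
  fixes u p :: "real ^ 2"
  assumes "convex P" "p \<in> rim u P"
  obtains a where "a \<noteq> 0" "a \<bullet> u \<ge> 0" "\<And>x. x \<in> P \<Longrightarrow> a \<bullet> x \<le> a \<bullet> p"
proof -
  define R where "R = (\<lambda>t. p + t *\<^sub>R u) ` {0<..}"
  have "convex R"
  proof -
    have "convex ((+) p ` (\<lambda>t. t *\<^sub>R u) ` {0<..})"
      by (intro convex_translation convex_linear_image) (auto intro!: linearI simp: algebra_simps)
    then show ?thesis by (simp add: R_def image_image)
  qed
  moreover have "R \<noteq> {}" "P \<noteq> {}" "P \<inter> R = {}"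
    using assms(2) by (auto simp: R_def rim_def)
  ultimately obtain a b where a: "a \<noteq> 0" "\<forall>x\<in>P. a \<bullet> x \<le> b" "\<forall>x\<in>R. b \<le> a \<bullet> x"
    using separating_hyperplane_sets[of P R] assms(1) by metis
  have ray: "b \<le> a \<bullet> p + t * (a \<bullet> u)" if "t > 0" for t
    using a(3) that by (auto simp: R_def inner_add_right)
  have pb: "a \<bullet> p \<le> b" using a(2) assms(2) by (auto simp: rim_def)
  have "a \<bullet> u \<ge> 0"
    using ray[of 1] pb by simp
  moreover have "b \<le> a \<bullet> p"
  proof (rule tendsto_lowerbound)
    show "((\<lambda>t. a \<bullet> p + t * (a \<bullet> u)) \<longlongrightarrow> a \<bullet> p) (at_right 0)"
      by (auto intro!: tendsto_eq_intros)
    show "\<forall>\<^sub>F t in at_right 0. b \<le> a \<bullet> p + t * (a \<bullet> u)"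
      using ray by (auto simp: eventually_at_right_less eventually_at_filter)
  qed simp
  ultimately show thesis using that a(1,2) by (meson order_trans)
qed

text \<open>A segment of \<open>P\<close> through \<open>p\<close> must stay in the vertical
  supporting line. Its ends would lie on opposite sides of \<open>p\<close>, yet no point of
  \<open>P\<close> lies beyond \<open>p\<close> along \<open>u\<close>.\<close>

lemma extreme_point_of_rim_vertical_support:
  fixes u p :: "real ^ 2"
  assumes u: "u $ 1 = 0" "u $ 2 \<noteq> 0" and p: "p \<in> rim u P"
    and a: "a \<noteq> 0" "a \<bullet> u = 0" "\<And>x. x \<in> P \<Longrightarrow> a \<bullet> x \<le> a \<bullet> p"
  shows "p extreme_point_of P"
proof -
  have a2: "a $ 2 = 0" using a(2) u by (simp add: inner_vec_def sum_2)
  have a1: "a $ 1 \<noteq> 0" using a(1) a2 by (simp add: vec_eq_iff forall_2)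
  have dot: "a \<bullet> x = a $ 1 * x $ 1" for x
    by (simp add: inner_vec_def sum_2 a2)
  have "False" if xy: "x \<in> P" "y \<in> P" "p \<in> open_segment x y" for x y
  proof -
    obtain s where s: "0 < s" "s < 1" "p = (1 - s) *\<^sub>R x + s *\<^sub>R y" and "x \<noteq> y"
      using xy(3) by (auto simp: in_segment)
    have ap: "a \<bullet> p = (1 - s) * (a \<bullet> x) + s * (a \<bullet> y)"
      by (simp add: s(3) inner_add_right)
    have "(1 - s) * (a \<bullet> x) \<le> (1 - s) * (a \<bullet> p)" "s * (a \<bullet> y) \<le> s * (a \<bullet> p)"
      using s(1,2) a(3) xy(1,2) by (auto intro: mult_left_mono)
    moreover have "(1 - s) * (a \<bullet> p) + s * (a \<bullet> p) = a \<bullet> p"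
      by (simp add: algebra_simps)
    ultimately have "(1 - s) * (a \<bullet> x) = (1 - s) * (a \<bullet> p)" "s * (a \<bullet> y) = s * (a \<bullet> p)"
      using ap by linarith+
    then have "x $ 1 = y $ 1"
      using s(1,2) a1 by (simp add: dot)
    then obtain c where c: "y = x + c *\<^sub>R u"
      using vertical_diffE u by metis
    have "y = p + ((1 - s) * c) *\<^sub>R u" "x = p + (- s * c) *\<^sub>R u"
      using s(3) c by (simp_all add: algebra_simps)
    then have "(1 - s) * c \<le> 0" "- s * c \<le> 0"
      using rim_le_0[OF p] xy(1,2) by metis+
    then have "c = 0"
      using s(1,2) by (simp add: zero_le_mult_iff mult_le_0_iff)
    then show False using c \<open>x \<noteq> y\<close> by simp
  qed
  then show ?thesis
    using p by (auto simp: extreme_point_of_def rim_def)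
qed

text \<open>If the supporting line at \<open>p\<close> is vertical, \<open>p\<close> itself is
  extreme. Otherwise the line cuts out a face inside the rim, which is a segment through
  \<open>p\<close> whose left end is extreme.\<close>

lemma rim_subset_rim_from:
  fixes u :: "real ^ 2"
  assumes u: "u $ 1 = 0" "u $ 2 \<noteq> 0" and P: "convex P" "compact P"
  shows "rim u P \<subseteq> (\<Union>v\<in>{v. v extreme_point_of P}. rim_from u P v)"
proof
  fix p assume p: "p \<in> rim u P"
  obtain a where a: "a \<noteq> 0" "a \<bullet> u \<ge> 0" "\<And>x. x \<in> P \<Longrightarrow> a \<bullet> x \<le> a \<bullet> p"
    using rim_supporting_normalE[OF P(1) p] by metis
  show "p \<in> (\<Union>v\<in>{v. v extreme_point_of P}. rim_from u P v)"
  proof (cases "a \<bullet> u = 0")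
    case True
    then have "p extreme_point_of P"
      using extreme_point_of_rim_vertical_support u p a by blast
    moreover have "closed_segment p p \<subseteq> rim u P" using p by simp
    ultimately show ?thesis
      unfolding rim_from_def by force
  next
    case False
    define F where "F = P \<inter> {x. a \<bullet> x = a \<bullet> p}"
    have face: "F face_of P"
      unfolding F_def by (intro face_of_Int_supporting_hyperplane_le P a)
    have FP: "F \<subseteq> rim u P"
    proof
      fix q assume q: "q \<in> F"
      have "q + t *\<^sub>R u \<notin> P" if "t > 0" for t
      proof
        assume "q + t *\<^sub>R u \<in> P"
        then have "a \<bullet> q + t * (a \<bullet> u) \<le> a \<bullet> p"
          using a(3) by (fastforce simp: inner_add_right)
        moreover have "t * (a \<bullet> u) > 0" using that a(2) False by simp
        ultimately show False using q by (simp add: F_def)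
      qed
      then show "q \<in> rim u P" using q by (auto simp: rim_def F_def)
    qed
    have injF: "inj_on (\<lambda>q. q $ 1) F"
      using inj_on_rim[OF u] FP inj_on_subset by blast
    have "compact F" "convex F"
      using P face face_of_imp_compact face_of_imp_convex by blast+
    have pF: "p \<in> F" using p by (simp add: F_def rim_def)
    have cont: "continuous_on F (\<lambda>q. q $ 1)" by (intro continuous_intros)
    obtain v where v: "v \<in> F" "\<And>q. q \<in> F \<Longrightarrow> v $ 1 \<le> q $ 1"
      using continuous_attains_inf[OF \<open>compact F\<close> _ cont] pF by blast
    obtain w where w: "w \<in> F" "\<And>q. q \<in> F \<Longrightarrow> q $ 1 \<le> w $ 1"
      using continuous_attains_sup[OF \<open>compact F\<close> _ cont] pF by blast
    \<comment> \<open>The leftmost points of \<open>F\<close> form a face of \<open>F\<close>, hence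
      of \<open>P\<close>. It is a single point because \<open>F\<close> is a graph.\<close>
    have "F \<inter> {x. axis 1 1 \<bullet> x = v $ 1} face_of F"
      using v(2) by (intro face_of_Int_supporting_hyperplane_ge \<open>convex F\<close>) (simp add: inner_axis')
    moreover have "F \<inter> {x. axis 1 1 \<bullet> x = v $ 1} = {v}"
      using v(1) injF by (auto simp: inner_axis' inj_on_def)
    ultimately have "v extreme_point_of P"
      using face face_of_trans face_of_singleton by metis
    moreover have seg: "closed_segment v w \<subseteq> F"
      using v w \<open>convex F\<close> by (simp add: closed_segment_subset)
    moreover have "p \<in> closed_segment v w"
    proof -
      obtain r where "r \<in> closed_segment v w" "r $ 1 = p $ 1"
        using closed_segment_coordinateE v(2) w(2) pF by metis
      then show ?thesis using seg injF pF by (metis inj_onD subsetD)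
    qed
    ultimately show ?thesis
      unfolding rim_from_def using FP v(2)[OF w(1)] by blast
  qed
qed

subsection \<open>Patterns seen at the rims\<close>

text \<open>The pattern of the germs at \<open>q\<close> is the one seen just before reaching
  \<open>q\<close> along \<open>u\<close>; membership of \<open>q\<close> itself is not
  tested.\<close>

definition germ :: "real ^ 2 \<Rightarrow> (real ^ 2) set \<Rightarrow> (real ^ 2) set" where
  "germ u P = {q. \<exists>e>0. \<forall>t. 0 < t \<and> t < e \<longrightarrow> q - t *\<^sub>R u \<in> P}"

lemma convex_germ:
  assumes "convex P"
  shows "convex (germ u P)"
proof (rule convexI)
  fix x y :: "real ^ 2" and a b :: real
  assume "x \<in> germ u P" "y \<in> germ u P" and ab: "0 \<le> a" "0 \<le> b" "a + b = 1"
  then obtain d e where d: "d > 0" "\<And>t. 0 < t \<Longrightarrow> t < d \<Longrightarrow> x - t *\<^sub>R u \<in> P"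
    and e: "e > 0" "\<And>t. 0 < t \<Longrightarrow> t < e \<Longrightarrow> y - t *\<^sub>R u \<in> P"
    unfolding germ_def by auto
  have "a *\<^sub>R x + b *\<^sub>R y - t *\<^sub>R u \<in> P" if "0 < t" "t < min d e" for t
  proof -
    have "a *\<^sub>R (x - t *\<^sub>R u) + b *\<^sub>R (y - t *\<^sub>R u) \<in> P"
      using assms ab d e that by (intro convexD) auto
    moreover have "a *\<^sub>R (x - t *\<^sub>R u) + b *\<^sub>R (y - t *\<^sub>R u)
        = a *\<^sub>R x + b *\<^sub>R y - ((a + b) * t) *\<^sub>R u"
      by (simp add: algebra_simps)
    ultimately show ?thesis using ab by simp
  qed
  then show "a *\<^sub>R x + b *\<^sub>R y \<in> germ u P"
    unfolding germ_def using d(1) e(1) by (auto intro!: exI[of _ "min d e"])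
qed

lemma compact_ray_preimage:
  fixes u p :: "real ^ 2"
  assumes "u \<noteq> 0" "compact P"
  shows "compact {t. 0 \<le> t \<and> p + t *\<^sub>R u \<in> P}"
proof -
  obtain B where B: "\<And>x. x \<in> P \<Longrightarrow> norm x \<le> B"
    using compact_imp_bounded[OF assms(2)] by (auto simp: bounded_iff)
  have "t \<le> (B + norm p) / norm u" if "0 \<le> t" "p + t *\<^sub>R u \<in> P" for t
  proof -
    have "norm (t *\<^sub>R u) \<le> norm (p + t *\<^sub>R u) + norm p"
      using norm_triangle_ineq4[of "p + t *\<^sub>R u" p] by simp
    then show ?thesis
      using B[OF that(2)] that(1) assms(1) by (simp add: field_simps)
  qed
  then have "bounded {t. 0 \<le> t \<and> p + t *\<^sub>R u \<in> P}"
    by (intro bounded_subset[OF bounded_closed_interval[of 0 "(B + norm p) / norm u"]]) auto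
  moreover have "closed ({0..} \<inter> (\<lambda>t. p + t *\<^sub>R u) -` P)"
    using assms(2)
    by (intro closed_Int closed_vimage compact_imp_closed continuous_intros) auto
  then have "closed {t. 0 \<le> t \<and> p + t *\<^sub>R u \<in> P}"
    by (simp add: vimage_def Int_def)
  ultimately show ?thesis by (simp add: compact_eq_bounded_closed)
qed

text \<open>Let \<open>m k\<close> be the first time a polygon of the pattern is left. If no other
  polygon has been met by then, the point of departure has the same pattern; otherwise the germs at
  the first meeting do.\<close>

lemma patt_at_rim:
  fixes u p :: "real ^ 2"
  assumes "u \<noteq> 0" and X: "\<And>i. i \<in> {1..n} \<Longrightarrow> convex (X i)" "\<And>i. i \<in> {1..n} \<Longrightarrow> compact (X i)"
    and "patt n X p \<noteq> {}"
  shows "\<exists>i\<in>{1..n}. patt n X p \<in> patt n X ` rim u (X i) \<or>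
    patt n X p \<in> patt n (\<lambda>j. germ u (X j)) ` rim (- u) (X i)"
proof -
  define I where "I i = {t. 0 \<le> t \<and> p + t *\<^sub>R u \<in> X i}" for i
  have compI: "compact (I i)" if "i \<in> {1..n}" for i
    unfolding I_def using compact_ray_preimage[OF \<open>u \<noteq> 0\<close> X(2)[OF that]] .
  define \<sigma> where "\<sigma> = patt n X p"
  have \<sigma>: "finite \<sigma>" "\<sigma> \<noteq> {}" "\<And>i. i \<in> \<sigma> \<Longrightarrow> i \<in> {1..n}"
    using assms(4) by (auto simp: \<sigma>_def patt_def)
  have zero: "0 \<in> I i" if "i \<in> \<sigma>" for i
    using that by (auto simp: \<sigma>_def patt_def I_def)
  have between: "t \<in> I i" if "i \<in> {1..n}" "r \<in> I i" "s \<in> I i" "r \<le> t" "t \<le> s" for i r s t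
  proof -
    have "t *\<^sub>R u = - p + x \<longleftrightarrow> x = p + t *\<^sub>R u" for t x
      by (metis add_minus_cancel minus_add_cancel)
    then have "I i = {0..} \<inter> (\<lambda>t. t *\<^sub>R u) -` ((\<lambda>x. - p + x) ` X i)"
      by (simp add: I_def image_iff set_eq_iff)
    moreover have "convex ({0..} \<inter> (\<lambda>t. t *\<^sub>R u) -` ((\<lambda>x. - p + x) ` X i))"
      using X(1)[OF that(1)]
      by (intro convex_Int convex_linear_vimage convex_translation)
        (auto intro!: linearI simp: algebra_simps)
    ultimately have "is_interval (I i)" by (simp add: is_interval_convex_1)
    then show ?thesis using that mem_is_interval_1_I by blast
  qed
  have "\<exists>r\<in>I i. \<forall>t\<in>I i. t \<le> r" if "i \<in> \<sigma>" for i
    using compact_attains_sup[OF compI[OF \<sigma>(3)[OF that]]] zero[OF that] by blast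
  then obtain m where m: "\<And>i. i \<in> \<sigma> \<Longrightarrow> m i \<in> I i" "\<And>i t. i \<in> \<sigma> \<Longrightarrow> t \<in> I i \<Longrightarrow> t \<le> m i"
    by metis
  obtain k where k: "k \<in> \<sigma>" "\<And>i. i \<in> \<sigma> \<Longrightarrow> m k \<le> m i"
    using \<sigma>(1,2) by (metis arg_min_least arg_min_if_finite(1))
  have stay: "t \<in> I i" if "i \<in> \<sigma>" "0 \<le> t" "t \<le> m k" for i t
    using between[of i 0 "m i" t] zero m k that \<sigma>(3) by force
  \<comment> \<open>The time \<open>m k\<close> is included: a polygon first met exactly on
    departure would spoil the pattern at that point, so this tie counts as an entry.\<close>
  define J where "J = (\<Union>j\<in>{1..n} - \<sigma>. I j) \<inter> {0..m k}"
  show ?thesis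
  proof (cases "J = {}")
    case True
    define q where "q = p + m k *\<^sub>R u"
    have mk: "0 \<le> m k" using m(1)[OF k(1)] by (simp add: I_def)
    have "q + t *\<^sub>R u \<notin> X k" if "t > 0" for t
    proof
      assume "q + t *\<^sub>R u \<in> X k"
      then have "m k + t \<in> I k" using mk that by (simp add: q_def I_def algebra_simps)
      then show False using m(2)[OF k(1)] that by force
    qed
    then have "q \<in> rim u (X k)"
      using m(1)[OF k(1)] by (simp add: rim_def q_def I_def)
    moreover have "patt n X q = \<sigma>"
    proof -
      have "q \<in> X i" if "i \<in> \<sigma>" for i
        using stay[OF that mk] by (simp add: I_def q_def)
      moreover have "i \<in> \<sigma>" if "i \<in> {1..n}" "q \<in> X i" for i
        using True that mk by (force simp: J_def I_def q_def)
      ultimately show ?thesis using \<sigma>(3) unfolding patt_def by blast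
    qed
    ultimately show ?thesis using k(1) \<sigma>(3) unfolding \<sigma>_def by blast
  next
    case False
    have "compact J"
      unfolding J_def using compI by (intro compact_Int_closed compact_UN) auto
    then obtain s where s: "s \<in> J" "\<And>t. t \<in> J \<Longrightarrow> s \<le> t"
      using compact_attains_inf[OF _ False] by metis
    obtain j where j: "j \<in> {1..n}" "j \<notin> \<sigma>" "s \<in> I j" "0 \<le> s" "s \<le> m k"
      using s(1) unfolding J_def by auto
    have outside: "t \<notin> I i" if "i \<in> {1..n}" "i \<notin> \<sigma>" "t < s" for i t
      using s(2)[of t] that j(5) by (force simp: J_def I_def)
    \<comment> \<open>At time \<open>0\<close> the pattern is \<open>\<sigma>\<close>, so the entry
      comes strictly later, leaving room for a germ.\<close>
    have "s \<noteq> 0" using j(1-3) by (auto simp: I_def \<sigma>_def patt_def)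
    then have "s > 0" using j(4) by simp
    define q where "q = p + s *\<^sub>R u"
    have q_back: "q - t *\<^sub>R u = p + (s - t) *\<^sub>R u" for t
      by (simp add: q_def algebra_simps)
    have "q - t *\<^sub>R u \<notin> X j" if "t > 0" for t
    proof
      assume *: "q - t *\<^sub>R u \<in> X j"
      show False
      proof (cases "t \<le> s")
        case True
        then have "s - t \<in> I j" using * q_back by (simp add: I_def)
        then show False using outside j that by force
      next
        \<comment> \<open>The point now lies behind \<open>p\<close>. As \<open>q\<close> is in
          \<open>X j\<close> too, convexity would put \<open>p\<close> into
          \<open>X j\<close>.\<close>
        case False
        define l where "l = s / t"
        have l: "0 \<le> l" "0 \<le> 1 - l" "l * t = s"
          using \<open>s > 0\<close> that False by (auto simp: l_def)
        have "(1 - l) *\<^sub>R q + l *\<^sub>R (q - t *\<^sub>R u) \<in> X j"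
          using X(1)[OF j(1)] j(3) * l by (intro convexD) (auto simp: I_def q_def)
        moreover have "(1 - l) *\<^sub>R q + l *\<^sub>R (q - t *\<^sub>R u) = q - (l * t) *\<^sub>R u"
          by (simp add: algebra_simps)
        ultimately have "p \<in> X j" using l(3) by (simp add: q_def)
        then show False using j by (simp add: \<sigma>_def patt_def)
      qed
    qed
    then have "q \<in> rim (- u) (X j)"
      using j(3) by (simp add: rim_def q_def I_def)
    moreover have "patt n (\<lambda>i. germ u (X i)) q = \<sigma>"
    proof -
      have "q \<in> germ u (X i)" if "i \<in> \<sigma>" for i
      proof -
        have "q - t *\<^sub>R u \<in> X i" if "0 < t" "t < s" for t
          using stay[OF \<open>i \<in> \<sigma>\<close>, of "s - t"] that j(5) by (simp add: I_def q_back)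
        then show ?thesis using \<open>s > 0\<close> by (auto simp: germ_def)
      qed
      moreover have "i \<in> \<sigma>" if i: "i \<in> {1..n}" "q \<in> germ u (X i)" for i
      proof (rule ccontr)
        assume "i \<notin> \<sigma>"
        obtain e where e: "e > 0" "\<And>t. 0 < t \<Longrightarrow> t < e \<Longrightarrow> q - t *\<^sub>R u \<in> X i"
          using i(2) by (auto simp: germ_def)
        \<comment> \<open>This time lies within the range of the germ and short of going back past
          \<open>p\<close>.\<close>
        define t where "t = min e s / 2"
        have t: "0 < t" "t < e" "t < s" using e(1) \<open>s > 0\<close> by (auto simp: t_def)
        then have "s - t \<in> I i" using e(2)[of t] by (simp add: I_def q_back)
        then show False using outside i(1) \<open>i \<notin> \<sigma>\<close> t by force
      qed
      ultimately show ?thesis using \<sigma>(3) unfolding patt_def by blast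
    qed
    ultimately show ?thesis using j(1) unfolding \<sigma>_def by blast
  qed
qed

section \<open>Counting patterns against vertices\<close>

theorem theorem2:
  fixes n :: nat and X :: "nat \<Rightarrow> (real ^ 2) set" and C :: "nat set set"
  assumes "n \<ge> 1"
    and "C \<subseteq> Pow {1..n}"
    and "realization n X C"
    and "\<And>i. i \<in> {1..n} \<Longrightarrow> closed_polygon (X i)"
  shows "real (\<Sum>i\<in>{1..n}. num_vertices (X i)) \<ge> real (card C) / (8 * real n)"
proof -
  define u :: "real ^ 2" where "u = axis 2 1"
  have u: "u $ 1 = 0" "u $ 2 \<noteq> 0" "(- u) $ 1 = 0" "(- u) $ 2 \<noteq> 0" "u \<noteq> 0"
    by (auto simp: u_def axis_def vec_eq_iff forall_2)
  have X: "convex (X i)" "compact (X i)" "X i \<noteq> {}" "finite {v. v extreme_point_of X i}"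
    if "i \<in> {1..n}" for i
    using assms(4)[OF that] unfolding closed_polygon_def
    by (auto simp: polytope_imp_convex polytope_imp_compact polytope_imp_polyhedron
        finite_polyhedron_extreme_points)
  \<comment> \<open>Tagging by \<open>i\<close> counts a point once for each polygon having it as a
    vertex, as the total does.\<close>
  define E where "E = (SIGMA i:{1..n}. {v. v extreme_point_of X i})"
  define V where "V = (\<Sum>i\<in>{1..n}. num_vertices (X i))"
  have finE: "finite E" and cardE: "card E = V"
    unfolding E_def V_def num_vertices_def using X(4) by (auto simp: card_SigmaI)
  have "V \<ge> 1"
  proof -
    obtain v where "v extreme_point_of X 1"
      using extreme_point_exists_convex X(1-3)[of 1] assms(1) by auto
    then have "(1, v) \<in> E" using assms(1) by (simp add: E_def)
    then have "E \<noteq> {}" by blast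
    then show ?thesis using finE cardE by (metis One_nat_def Suc_leI card_gt_0_iff)
  qed
  \<comment> \<open>\<open>A\<close> collects patterns at departures, \<open>B\<close> those just
    before entries.\<close>
  define A where "A = (\<lambda>(i, v). patt n X ` rim_from u (X i) v)"
  define B where "B = (\<lambda>(i, v). patt n (\<lambda>j. germ u (X j)) ` rim_from (- u) (X i) v)"
  have fin: "finite (A e \<union> B e)" for e
    by (auto simp: A_def B_def finite_patt_image split: prod.split)
  have "card (A e \<union> B e) \<le> 2 * (2 * n + 1)" for e
  proof -
    have "card (A e) \<le> 2 * n + 1" "card (B e) \<le> 2 * n + 1"
      using u X(1) convex_germ
      by (auto simp: A_def B_def split: prod.split intro!: card_patt_rim_from_le[simplified])
    then show ?thesis using card_Un_le[of "A e" "B e"] by simp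
  qed
  then have "(\<Sum>e\<in>E. card (A e \<union> B e)) \<le> V * (2 * (2 * n + 1))"
    using sum_bounded_above[of E "\<lambda>e. card (A e \<union> B e)" "2 * (2 * n + 1)"] cardE by simp
  then have "card (\<Union>e\<in>E. A e \<union> B e) \<le> V * (2 * (2 * n + 1))"
    using card_UN_le[OF finE] le_trans by blast
  \<comment> \<open>The empty pattern is added by hand, since a ray from a point outside all
    polygons may meet none of them.\<close>
  moreover have "C \<subseteq> insert {} (\<Union>e\<in>E. A e \<union> B e)"
  proof
    fix \<sigma> assume "\<sigma> \<in> C"
    then obtain p where p: "\<sigma> = patt n X p"
      using assms(3) by (auto simp: realization_def convex_code_def)
    show "\<sigma> \<in> insert {} (\<Union>e\<in>E. A e \<union> B e)"
    proof (cases "\<sigma> = {}")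
      case False
      then obtain i where i: "i \<in> {1..n}" and "\<sigma> \<in> patt n X ` rim u (X i) \<or>
          \<sigma> \<in> patt n (\<lambda>j. germ u (X j)) ` rim (- u) (X i)"
        using patt_at_rim[of u n X p] u(5) X(1,2) p by blast
      then have "\<exists>v. v extreme_point_of X i \<and> \<sigma> \<in> A (i, v) \<union> B (i, v)"
        using rim_subset_rim_from[OF u(1,2) X(1,2)[OF i]]
          rim_subset_rim_from[OF u(3,4) X(1,2)[OF i]]
        unfolding A_def B_def by fast
      then show ?thesis using i by (auto simp: E_def)
    qed simp
  qed
  then have "card C \<le> Suc (card (\<Union>e\<in>E. A e \<union> B e))"
    using card_mono[of "insert {} (\<Union>e\<in>E. A e \<union> B e)" C] fin finE
    by (auto simp: card_insert_if split: if_splits)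
  ultimately have "card C \<le> 4 * (V * n) + 2 * V + 1"
    by (simp add: algebra_simps)
  \<comment> \<open>Since \<open>1 \<le> V\<close> and \<open>V \<le> V * n\<close>, the terms
    \<open>2 * V\<close> and \<open>1\<close> are at most \<open>2 * (V * n)\<close> and
    \<open>V * n\<close>.\<close>
  also have "\<dots> \<le> 8 * (V * n)"
  proof -
    have "V \<le> V * n" using assms(1) by simp
    then show ?thesis using \<open>V \<ge> 1\<close> by linarith
  qed
  finally have "real (card C) \<le> real V * (8 * real n)"
    by (metis (no_types, opaque_lifting) mult.left_commute of_nat_le_iff of_nat_mult of_nat_numeral)
  then show ?thesis
    using assms(1) unfolding V_def by (simp add: pos_divide_le_eq)
qed

end
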